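(* For every $m$ and every $n\ge1$, the function $$g_m(x)=\frac{1+\operatorname{sn}(x,m)}{\operatorname{cn}(x,m)}$$ satisfies $$\ddot H_n(g_m)=\Bigl(\frac{1-m}{2}\Bigr)^{\binom n2}\prod_{k=1}^{n-1}k!\,(2k)!.$$
   Context: For a power series $f(x)=\sum_{k\ge0}a_kx^k/k!$, the dilated Hankel determinant is $\ddot H_n(f)=\det(a_{2i+j})_{0\le i,j\le n-1}$. $\operatorname{sn}(x,m),\operatorname{cn}(x,m),\operatorname{dn}(x,m)$ are the Jacobi elliptic functions with parameter $m=k^2$ ($k$ the modulus): with $u=\int_0^{\phi}(1-m\sin^2\theta)^{-1/2}d\theta$ one has $\operatorname{sn}(u,m)=\sin\phi$, $\operatorname{cn}(u,m)=\cos\phi$, $\operatorname{dn}(u,m)=(1-m\sin^2\phi)^{1/2}$. Equivalently, as power series in $x$, they satisfy $\operatorname{sn}'=\operatorname{cn}\operatorname{dn}$, $\operatorname{cn}'=-\operatorname{sn}\operatorname{dn}$, $\operatorname{dn}'=-m\operatorname{sn}\operatorname{cn}$ with values $0,1,1$ at $x=0$. The coefficients $k!\,[x^k]g_m$ are polynomials in $m$. Empty products equal $1$. *)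

theory Defs
  imports
    "Jordan_Normal_Form.Determinant"
    "HOL-Computational_Algebra.Formal_Power_Series"
begin

text \<open>
  The Jacobi elliptic functions with parameter \<open>m = k\<^sup>2\<close>, as formal power series over a field of
  characteristic 0. The recursion is the coefficientwise form of the system
  \<open>sn' = cn dn\<close>, \<open>cn' = - sn dn\<close>, \<open>dn' = - m sn cn\<close> with values \<open>0, 1, 1\<close> at \<open>0\<close>;
  lemma \<open>jacobi_system_iff\<close> below shows that it defines the unique solution of this system.
\<close>

function (sequential)
  sn_coeff :: "'a::field_char_0 \<Rightarrow> nat \<Rightarrow> 'a" and
  cn_coeff :: "'a \<Rightarrow> nat \<Rightarrow> 'a" and
  dn_coeff :: "'a \<Rightarrow> nat \<Rightarrow> 'a"
where
  "sn_coeff m 0 = 0"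
| "sn_coeff m (Suc k) = (\<Sum>i=0..k. cn_coeff m i * dn_coeff m (k - i)) / of_nat (Suc k)"
| "cn_coeff m 0 = 1"
| "cn_coeff m (Suc k) = - (\<Sum>i=0..k. sn_coeff m i * dn_coeff m (k - i)) / of_nat (Suc k)"
| "dn_coeff m 0 = 1"
| "dn_coeff m (Suc k) = - m * (\<Sum>i=0..k. sn_coeff m i * cn_coeff m (k - i)) / of_nat (Suc k)"
  by pat_completeness auto
termination
  by (relation "measure (\<lambda>x. case x of Inl (_, k) \<Rightarrow> k | Inr (Inl (_, k)) \<Rightarrow> k | Inr (Inr (_, k)) \<Rightarrow> k)") auto

definition jacobi_sn :: "'a::field_char_0 \<Rightarrow> 'a fps" where
  "jacobi_sn m = Abs_fps (sn_coeff m)"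

definition jacobi_cn :: "'a::field_char_0 \<Rightarrow> 'a fps" where
  "jacobi_cn m = Abs_fps (cn_coeff m)"

definition jacobi_dn :: "'a::field_char_0 \<Rightarrow> 'a fps" where
  "jacobi_dn m = Abs_fps (dn_coeff m)"

lemma jacobi_deriv:
  "fps_deriv (jacobi_sn m) = jacobi_cn m * jacobi_dn m"
  "fps_deriv (jacobi_cn m) = - (jacobi_sn m * jacobi_dn m)"
  "fps_deriv (jacobi_dn m) = - (fps_const m * (jacobi_sn m * jacobi_cn m))"
  unfolding fps_eq_iff fps_deriv_nth fps_mult_left_const_nth fps_neg_nth
  by (simp_all add: jacobi_sn_def jacobi_cn_def jacobi_dn_def fps_mult_nth del: of_nat_Suc)

lemma jacobi_nth_0:
  "fps_nth (jacobi_sn m) 0 = 0" "fps_nth (jacobi_cn m) 0 = 1" "fps_nth (jacobi_dn m) 0 = 1"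
  by (simp_all add: jacobi_sn_def jacobi_cn_def jacobi_dn_def)

lemma jacobi_system_iff:
  fixes m :: "'a::field_char_0" and S C D :: "'a fps"
  shows "fps_deriv S = C * D \<and> fps_deriv C = - (S * D) \<and>
      fps_deriv D = - (fps_const m * (S * C)) \<and>
      fps_nth S 0 = 0 \<and> fps_nth C 0 = 1 \<and> fps_nth D 0 = 1 \<longleftrightarrow>
    S = jacobi_sn m \<and> C = jacobi_cn m \<and> D = jacobi_dn m"
    (is "?sys \<longleftrightarrow> ?eq")
proof
  assume sys: ?sys
  have step: "fps_nth F (Suc k) = fps_nth (fps_deriv F) k / of_nat (Suc k)" for F :: "'a fps" and k
    by (simp del: of_nat_Suc)
  have "fps_nth S k = sn_coeff m k \<and> fps_nth C k = cn_coeff m k \<and> fps_nth D k = dn_coeff m k" for k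
  proof (induction k rule: less_induct)
    case (less k)
    show ?case
    proof (cases k)
      case 0
      then show ?thesis using sys by simp
    next
      case (Suc j)
      have IH: "fps_nth S i = sn_coeff m i" "fps_nth C i = cn_coeff m i"
        "fps_nth D i = dn_coeff m i" if "i \<le> j" for i
        using less Suc that by auto
      have *: "fps_nth (C * D) j = (\<Sum>i=0..j. cn_coeff m i * dn_coeff m (j - i))"
        "fps_nth (S * D) j = (\<Sum>i=0..j. sn_coeff m i * dn_coeff m (j - i))"
        "fps_nth (S * C) j = (\<Sum>i=0..j. sn_coeff m i * cn_coeff m (j - i))"
        by (simp_all add: fps_mult_nth IH)
      show ?thesis
        unfolding Suc step using sys * by (simp del: of_nat_Suc)
    qed
  qed
  then show ?eq
    by (simp add: fps_eq_iff jacobi_sn_def jacobi_cn_def jacobi_dn_def)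
next
  assume ?eq
  then show ?sys
    by (simp add: jacobi_deriv jacobi_nth_0)
qed

text \<open>The \<open>a\<^sub>k\<close> of \<open>f(x) = \<Sum> a\<^sub>k x\<^sup>k / k!\<close>.\<close>

definition egf_coeff :: "'a::field_char_0 fps \<Rightarrow> nat \<Rightarrow> 'a" where
  "egf_coeff f k = fact k * fps_nth f k"

definition dilated_hankel_det :: "nat \<Rightarrow> 'a::field_char_0 fps \<Rightarrow> 'a" where
  "dilated_hankel_det n f = det (mat n n (\<lambda>(i, j). egf_coeff f (2 * i + j)))"

text \<open>The division is exact, since \<open>cn\<close> has constant coefficient 1 and so is a unit.\<close>

definition jacobi_g :: "'a::field_char_0 \<Rightarrow> 'a fps" where
  "jacobi_g m = (1 + jacobi_sn m) / jacobi_cn m"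

end

theory Submission
  imports Defs
begin

text \<open>
  The function \<open>g = (1 + sn) / cn\<close> satisfies \<open>g' = g dn / cn\<close>. With \<open>t = g\<^sup>2 - 1\<close> and
  \<open>k = (1 - m) / 4\<close> this gives \<open>g'\<^sup>2 = 1 + t + k t\<^sup>2\<close> and hence \<open>g'' = g (1 + 2 k t)\<close>, so every
  derivative of even order \<open>2 i\<close> is \<open>g P\<^sub>i(t)\<close> with \<open>P\<^sub>i\<close> a polynomial of degree at most \<open>i\<close> and
  \<open>t\<^sup>i\<close>-coefficient \<open>k\<^sup>i (2 i)!\<close>. As \<open>t = 2 x + \<dots>\<close>, the series \<open>g t\<^sup>i\<close> starts with \<open>2\<^sup>i x\<^sup>i\<close>. The dilated
  Hankel matrix is therefore the product of the lower triangular matrix of the coefficients of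
  the \<open>P\<^sub>i\<close> and the upper triangular matrix with diagonal entries \<open>2\<^sup>i i!\<close>.
\<close>

section \<open>Algebraic relations and the first derivative of g\<close>

lemma jacobi_sn_cn: "jacobi_sn m ^ 2 + jacobi_cn m ^ 2 = 1"
proof -
  have "fps_deriv (jacobi_sn m ^ 2 + jacobi_cn m ^ 2) = fps_deriv 1"
    by (simp add: power2_eq_square jacobi_deriv algebra_simps)
  then show ?thesis
    unfolding fps_deriv_eq_iff by (simp add: power2_eq_square jacobi_nth_0)
qed

lemma jacobi_sn_dn: "fps_const m * jacobi_sn m ^ 2 + jacobi_dn m ^ 2 = 1"
proof -
  have "fps_deriv (fps_const m * jacobi_sn m ^ 2 + jacobi_dn m ^ 2) = fps_deriv 1"
    by (simp add: power2_eq_square jacobi_deriv algebra_simps)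
  then show ?thesis
    unfolding fps_deriv_eq_iff by (simp add: power2_eq_square jacobi_nth_0)
qed

lemma jacobi_cn_nonzero: "jacobi_cn m \<noteq> 0"
  using jacobi_nth_0(2)[of m] by auto

text \<open>\<open>jacobi_cn m\<close> is a unit, so the division is exact. All later facts about
  \<open>jacobi_g\<close> rest on this product form.\<close>

lemma jacobi_g_mult_cn: "jacobi_g m * jacobi_cn m = 1 + jacobi_sn m"
proof -
  have "jacobi_cn m dvd 1 + jacobi_sn m"
    using jacobi_nth_0(2)[of m] by (simp add: unit_imp_dvd fps_is_unit_iff)
  then show ?thesis by (simp add: jacobi_g_def)
qed

text \<open>In the next two identities \<open>x\<close> stands for \<open>g'\<close>. The method name is qualified because
  HOL-Algebra shadows \<open>algebra\<close>.\<close>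

lemma cn_mult_deriv_identity:
  fixes s c d g x :: "'a::idom"
  assumes "x * c - g * (s * d) = c * d" "g * c = 1 + s" "s ^ 2 + c ^ 2 = 1"
  shows "c * (c * x) = c * (d * g)"
  using assms by Groebner_Basis.algebra

lemma deriv_square_identity:
  fixes s c d g x m k :: "'a::idom"
  assumes gc: "g * c = 1 + s" and sc: "s ^ 2 + c ^ 2 = 1" and sd: "m * s ^ 2 + d ^ 2 = 1"
    and x: "c * x = d * g" and k: "4 * k = 1 - m" and nz: "1 + s \<noteq> 0"
  shows "(4 * c ^ 2) * x ^ 2 = (4 * c ^ 2) * (1 + (g ^ 2 - 1) + k * (g ^ 2 - 1) ^ 2)"
proof -
  \<comment> \<open>Both sides equal \<open>(g * c) ^ 2\<close>, as
    \<open>c ^ 2 = (1 + s) * (1 - s)\<close>.\<close>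
  have "(1 + s) * (g ^ 2 * (1 - s)) = (1 + s) * (1 + s)"
    using gc sc by Groebner_Basis.algebra
  then have g2: "g ^ 2 * (1 - s) = 1 + s"
    using nz by (metis mult_cancel_left)
  have c2: "c ^ 2 = g ^ 2 * (1 - s) ^ 2"
    using g2 sc by Groebner_Basis.algebra
  have "(4 * c ^ 2) * x ^ 2 = 4 * d ^ 2 * g ^ 2"
    using x by Groebner_Basis.algebra
  \<comment> \<open>This splits \<open>4 * d ^ 2 = 4 - 4 * m * s ^ 2\<close> along
    \<open>(1 + s) ^ 2\<close>, \<open>1 - s ^ 2\<close> and \<open>(1 - s) ^ 2\<close>; multiplied
    by \<open>g ^ 2\<close>, these become \<open>c ^ 2\<close> times \<open>g ^ 4\<close>,
    \<open>g ^ 2\<close> and \<open>1\<close>.\<close>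
  also have "\<dots> = g ^ 2 * ((1 - m) * (1 + s) ^ 2 + 2 * (1 + m) * (1 - s ^ 2) + (1 - m) * (1 - s) ^ 2)"
    using sd by Groebner_Basis.algebra
  also have "\<dots> = c ^ 2 * ((1 - m) * g ^ 4 + 2 * (1 + m) * g ^ 2 + (1 - m))"
    using c2 g2 sc by Groebner_Basis.algebra
  also have "\<dots> = (4 * c ^ 2) * (1 + (g ^ 2 - 1) + k * (g ^ 2 - 1) ^ 2)"
    using k by Groebner_Basis.algebra
  finally show ?thesis .
qed

lemma cn_mult_deriv_jacobi_g:
  "jacobi_cn m * fps_deriv (jacobi_g m) = jacobi_dn m * jacobi_g m"
proof -
  let ?s = "jacobi_sn m" and ?c = "jacobi_cn m" and ?d = "jacobi_dn m" and ?g = "jacobi_g m"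
  have "fps_deriv (?g * ?c) = ?c * ?d"
    unfolding jacobi_g_mult_cn by (simp add: jacobi_deriv)
  then have "fps_deriv ?g * ?c - ?g * (?s * ?d) = ?c * ?d"
    by (simp add: jacobi_deriv algebra_simps)
  \<comment> \<open>The extra factor \<open>?c\<close> brings in
    \<open>?c ^ 2 + ?s * (1 + ?s) = 1 + ?s = ?g * ?c\<close>.\<close>
  then have "?c * (?c * fps_deriv ?g) = ?c * (?d * ?g)"
    by (rule cn_mult_deriv_identity[OF _ jacobi_g_mult_cn jacobi_sn_cn])
  then show ?thesis by (simp add: jacobi_cn_nonzero)
qed

lemma jacobi_g_nth_0: "fps_nth (jacobi_g m) 0 = 1"
  using arg_cong[OF jacobi_g_mult_cn[of m], of "\<lambda>f. fps_nth f 0"] by (simp add: jacobi_nth_0)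

lemma jacobi_g_nth_1: "fps_nth (jacobi_g m) 1 = 1"
  using arg_cong[OF cn_mult_deriv_jacobi_g[of m], of "\<lambda>f. fps_nth f 0"]
  by (simp add: jacobi_nth_0 jacobi_g_nth_0)

section \<open>Differential equations for g in terms of t\<close>

definition jacobi_t :: "'a::field_char_0 \<Rightarrow> 'a fps" where
  "jacobi_t m = jacobi_g m ^ 2 - 1"

lemma jacobi_t_nth: "fps_nth (jacobi_t m) 0 = 0" "fps_nth (jacobi_t m) 1 = 2"
  using jacobi_g_nth_0[of m] jacobi_g_nth_1[of m]
  by (simp_all add: jacobi_t_def power2_eq_square fps_mult_nth)

lemma deriv_jacobi_t: "fps_deriv (jacobi_t m) = 2 * jacobi_g m * fps_deriv (jacobi_g m)"
  by (simp add: jacobi_t_def power2_eq_square algebra_simps)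

lemma deriv_jacobi_g_square:
  "fps_deriv (jacobi_g m) ^ 2 =
    1 + jacobi_t m + fps_const ((1 - m) / 4) * jacobi_t m ^ 2"
proof -
  let ?s = "jacobi_sn m" and ?c = "jacobi_cn m" and ?g = "jacobi_g m"
  let ?m = "fps_const m" and ?k = "fps_const ((1 - m) / 4)"
  have k: "4 * ?k = 1 - ?m"
    by (simp add: numeral_fps_const diff_divide_distrib flip: fps_const_1_eq_1)
  have nz: "1 + ?s \<noteq> 0"
    using jacobi_nth_0(1)[of m] by (metis add.right_neutral fps_add_nth fps_one_nth fps_zero_nth zero_neq_one)
  have "(4 * ?c ^ 2) * fps_deriv ?g ^ 2 = (4 * ?c ^ 2) * (1 + jacobi_t m + ?k * jacobi_t m ^ 2)"
    unfolding jacobi_t_def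
    by (rule deriv_square_identity[OF jacobi_g_mult_cn jacobi_sn_cn jacobi_sn_dn
          cn_mult_deriv_jacobi_g k nz])
  then show ?thesis
    using jacobi_cn_nonzero[of m] by simp
qed

text \<open>Differentiate the equation for \<open>g'\<^sup>2\<close> and cancel \<open>2 g'\<close>,
  which is nonzero since \<open>g'\<close> has constant coefficient 1.\<close>

lemma deriv2_jacobi_g:
  "fps_deriv (fps_deriv (jacobi_g m)) =
    jacobi_g m * (1 + 2 * fps_const ((1 - m) / 4) * jacobi_t m)"
proof -
  let ?g' = "fps_deriv (jacobi_g m)"
  have nz: "?g' \<noteq> 0"
    using jacobi_g_nth_1[of m] by (auto simp: fps_eq_iff intro!: exI[of _ 0])
  have "2 * ?g' * fps_deriv ?g' = fps_deriv (?g' ^ 2)"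
    by (simp add: power2_eq_square)
  also have "\<dots> = 2 * ?g' * (jacobi_g m * (1 + 2 * fps_const ((1 - m) / 4) * jacobi_t m))"
    unfolding deriv_jacobi_g_square
    by (simp add: power2_eq_square deriv_jacobi_t algebra_simps)
  finally show ?thesis using nz by simp
qed

section \<open>Second derivatives as an operator on series in t\<close>

text \<open>\<open>g \<cdot> P(t) \<mapsto> (g \<cdot> P(t))''\<close> in the coordinate \<open>t = g\<^sup>2 - 1\<close>.\<close>

definition jacobi_op :: "'a::field_char_0 \<Rightarrow> 'a fps \<Rightarrow> 'a fps" where
  "jacobi_op m P = (let Q = P + 2 * (1 + fps_X) * fps_deriv P; k = fps_const ((1 - m) / 4) in
    (1 + 2 * k * fps_X) * Q + 2 * (1 + fps_X + k * fps_X ^ 2) * fps_deriv Q)"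

lemma deriv2_compose_jacobi_t:
  "fps_deriv (fps_deriv (jacobi_g m * (P oo jacobi_t m))) =
    jacobi_g m * (jacobi_op m P oo jacobi_t m)"
proof -
  let ?g = "jacobi_g m" and ?t = "jacobi_t m" and ?k = "fps_const ((1 - m) / 4)"
  let ?g' = "fps_deriv ?g"
  \<comment> \<open>The half step: one derivative turns \<open>g P(t)\<close> into
    \<open>g' Q(t)\<close>, with \<open>g\<^sup>2 = 1 + t\<close> absorbing the square from the
    chain rule. The second derivative returns to the form \<open>g R(t)\<close>.\<close>
  define Q where "Q = P + 2 * (1 + fps_X) * fps_deriv P"
  note t0 = jacobi_t_nth(1)[of m]
  note hom = fps_compose_add_distrib fps_compose_mult_distrib[OF t0] fps_compose_power[OF t0, symmetric]
 fps_X_fps_compose_startby0[OF t0] fps_const_compose numeral_compose fps_compose_1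
  have chain: "fps_deriv (A oo ?t) = (fps_deriv A oo ?t) * (2 * ?g * ?g')" for A
    by (simp add: fps_compose_deriv[OF t0] deriv_jacobi_t)
  have g2: "?g ^ 2 = 1 + ?t"
    by (simp add: jacobi_t_def)
  have "fps_deriv (?g * (P oo ?t)) = ?g' * ((P oo ?t) + 2 * ?g ^ 2 * (fps_deriv P oo ?t))"
    by (simp add: chain power2_eq_square algebra_simps)
  also have "\<dots> = ?g' * (Q oo ?t)"
    unfolding g2 Q_def hom by (simp add: hom)
  finally have 1: "fps_deriv (?g * (P oo ?t)) = ?g' * (Q oo ?t)" .
  have "fps_deriv (?g' * (Q oo ?t)) =
      fps_deriv ?g' * (Q oo ?t) + 2 * ?g * ?g' ^ 2 * (fps_deriv Q oo ?t)"
    by (simp add: chain power2_eq_square algebra_simps)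
  also have "\<dots> = ?g * ((1 + 2 * ?k * ?t) * (Q oo ?t) +
      2 * (1 + ?t + ?k * ?t ^ 2) * (fps_deriv Q oo ?t))"
    unfolding deriv2_jacobi_g deriv_jacobi_g_square by (simp add: algebra_simps)
  also have "\<dots> = ?g * (jacobi_op m P oo ?t)"
    unfolding jacobi_op_def Let_def Q_def[symmetric] hom by simp
  finally show ?thesis using 1 by simp
qed

lemma deriv_even_jacobi_g:
  "(fps_deriv ^^ (2 * i)) (jacobi_g m) = jacobi_g m * ((jacobi_op m ^^ i) 1 oo jacobi_t m)"
  by (induction i) (simp_all add: deriv2_compose_jacobi_t del: fps_deriv_mult)

text \<open>Only the degree-raising terms reach index \<open>Suc j\<close>. For
  \<open>j = i\<close>, the passage from \<open>P\<close> to \<open>Q\<close> gives the factor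
  \<open>2 i + 1\<close>, and \<open>2 k X Q + 2 k X\<^sup>2 Q'\<close> gives
  \<open>2 k (i + 1)\<close>.\<close>

lemma jacobi_op_nth_Suc:
  assumes "\<And>j. j > i \<Longrightarrow> fps_nth P j = 0" "j \<ge> i"
  shows "fps_nth (jacobi_op m P) (Suc j) =
    (if j = i then (1 - m) / 4 * of_nat ((2 * i + 1) * (2 * i + 2)) * fps_nth P i else 0)"
proof -
  define Q where "Q = P + 2 * (1 + fps_X) * fps_deriv P"
  define k where "k = (1 - m) / 4"
  have "Q = P + (fps_const 2 * fps_deriv P + fps_const 2 * (fps_X * fps_deriv P))"
    by (simp add: Q_def algebra_simps numeral_fps_const)
  then have Qn: "fps_nth Q l = of_nat (2 * l + 1) * fps_nth P l + 2 * of_nat (l + 1) * fps_nth P (l + 1)" for l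
    by (cases l) (simp_all add: algebra_simps)
  have Q0: "fps_nth Q l = 0" if "l > i" for l
    using that by (simp add: Qn assms(1))
  have "jacobi_op m P = Q + fps_const (2 * k) * (fps_X * Q) +
      (fps_const 2 * fps_deriv Q + fps_const 2 * (fps_X * fps_deriv Q) +
        fps_const (2 * k) * (fps_X * (fps_X * fps_deriv Q)))"
    unfolding jacobi_op_def Let_def Q_def[symmetric] k_def[symmetric] fps_const_mult[symmetric]
    by (simp add: numeral_fps_const algebra_simps power2_eq_square del: fps_const_mult)
  then have "fps_nth (jacobi_op m P) (Suc j) = 2 * k * of_nat (j + 1) * fps_nth Q j"
    using assms(2) by (cases j) (simp_all add: Q0 algebra_simps)
  also have "\<dots> = (if j = i then k * of_nat ((2 * i + 1) * (2 * i + 2)) * fps_nth P i else 0)"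
    using assms(2) by (auto simp: Qn assms(1) algebra_simps Q0)
  finally show ?thesis by (simp only: k_def)
qed

text \<open>The factors \<open>(2 i + 1) (2 i + 2)\<close> accumulate to \<open>(2 i)!\<close>. The
  vanishing for \<open>j > i\<close> is proved along with this because the induction step needs
  it.\<close>

lemma jacobi_op_power_nth:
  assumes "j \<ge> i"
  shows "fps_nth ((jacobi_op m ^^ i) 1) j = (if j = i then ((1 - m) / 4) ^ i * fact (2 * i) else 0)"
  using assms
proof (induction i arbitrary: j)
  case 0
  then show ?case by simp
next
  case (Suc i)
  then obtain l where l: "j = Suc l" "l \<ge> i" by (cases j) auto
  have "fps_nth ((jacobi_op m ^^ i) 1) l = 0" if "l > i" for l
    using that Suc.IH by simp
  from jacobi_op_nth_Suc[OF this l(2)] show ?case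
    using Suc.IH[of i] by (simp add: l(1) algebra_simps)
qed

section \<open>Triangular factorization of the Hankel matrix\<close>

text \<open>Powers \<open>t ^ k\<close> with \<open>k \<ge> n\<close> start beyond index
  \<open>j\<close>. The cutoff \<open>n\<close> is the same for all \<open>j\<close>, so the sum is
  an entry of an \<open>n\<close> by \<open>n\<close> matrix product.\<close>

lemma fps_mult_compose_nth:
  fixes g t P :: "'a::comm_ring_1 fps"
  assumes "fps_nth t 0 = 0" "j < n"
  shows "fps_nth (g * (P oo t)) j = (\<Sum>k<n. fps_nth P k * fps_nth (g * t ^ k) j)"
proof -
  have "fps_nth (P oo t) l = (\<Sum>k<n. fps_nth P k * fps_nth (t ^ k) l)" if "l < n" for l
    unfolding fps_compose_nth using that startsby_zero_power_prefix[OF assms(1)]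
    by (intro sum.mono_neutral_left) auto
  then have "fps_nth (g * (P oo t)) j =
      (\<Sum>l=0..j. fps_nth g l * (\<Sum>k<n. fps_nth P k * fps_nth (t ^ k) (j - l)))"
    using assms(2) by (simp add: fps_mult_nth)
  also have "\<dots> = (\<Sum>l=0..j. \<Sum>k<n. fps_nth P k * (fps_nth g l * fps_nth (t ^ k) (j - l)))"
    by (simp add: sum_distrib_left mult.left_commute)
  also have "\<dots> = (\<Sum>k<n. fps_nth P k * fps_nth (g * t ^ k) j)"
    by (subst sum.swap) (simp add: sum_distrib_left fps_mult_nth)
  finally show ?thesis .
qed

lemma fps_mult_power_nth:
  fixes g t :: "'a::comm_ring_1 fps"
  assumes "fps_nth t 0 = 0" "j \<le> k"
  shows "fps_nth (g * t ^ k) j = (if j = k then fps_nth g 0 * fps_nth t 1 ^ k else 0)"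
proof -
  \<comment> \<open>For \<open>l > 0\<close> the index \<open>j - l\<close> lies below
    \<open>k\<close>, where \<open>t ^ k\<close> has no terms.\<close>
  have "fps_nth (g * t ^ k) j = (\<Sum>l=0..j. if l = 0 then fps_nth g 0 * fps_nth (t ^ k) j else 0)"
    unfolding fps_mult_nth using assms startsby_zero_power_prefix[OF assms(1), of k]
    by (intro sum.cong) auto
  also have "\<dots> = fps_nth g 0 * fps_nth (t ^ k) j"
    by simp
  finally show ?thesis
    using assms startsby_zero_power_prefix[OF assms(1), of k]
    by (auto simp: startsby_zero_power_nth_same)
qed

text \<open>Used with \<open>2 * i\<close> for \<open>i\<close>: row \<open>i\<close> of the dilated
  Hankel matrix is read off the derivative of order \<open>2 i\<close>.\<close>

lemma egf_coeff_add: "egf_coeff f (i + j) = fact j * fps_nth ((fps_deriv ^^ i) f) j"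
proof (induction i arbitrary: f)
  case (Suc i)
  have "egf_coeff f (Suc i + j) = egf_coeff (fps_deriv f) (i + j)"
    by (simp add: egf_coeff_def algebra_simps)
  then show ?case by (simp add: Suc funpow_swap1)
qed (simp add: egf_coeff_def)

theorem theorem19p1:
  fixes m :: "'a::field_char_0" and n :: nat
  assumes "n \<ge> 1"
  shows "dilated_hankel_det n (jacobi_g m) =
    ((1 - m) / 2) ^ (n choose 2) * (\<Prod>k=1..n-1. fact k * fact (2 * k))"
proof -
  define L where "L = mat n n (\<lambda>(i, k). fps_nth ((jacobi_op m ^^ i) 1) k)"
  define U where "U = mat n n (\<lambda>(k, j). fact j * fps_nth (jacobi_g m * jacobi_t m ^ k) j)"
  have carr: "L \<in> carrier_mat n n" "U \<in> carrier_mat n n"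
    by (simp_all add: L_def U_def)
  have "mat n n (\<lambda>(i, j). egf_coeff (jacobi_g m) (2 * i + j)) = L * U"
  proof (rule eq_matI)
    fix i j assume "i < dim_row (L * U)" "j < dim_col (L * U)"
    then have ij: "i < n" "j < n" by (simp_all add: L_def U_def)
    then show "mat n n (\<lambda>(i, j). egf_coeff (jacobi_g m) (2 * i + j)) $$ (i, j) = (L * U) $$ (i, j)"
      by (simp add: L_def U_def scalar_prod_def egf_coeff_add deriv_even_jacobi_g
          fps_mult_compose_nth[OF jacobi_t_nth(1) ij(2)] sum_distrib_left lessThan_atLeast0
          mult.left_commute)
  qed (simp_all add: L_def U_def)
  then have "dilated_hankel_det n (jacobi_g m) = det L * det U"
    by (simp add: dilated_hankel_det_def det_mult[OF carr])
  also have "det L = (\<Prod>i<n. ((1 - m) / 4) ^ i * fact (2 * i))"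
    by (subst det_lower_triangular[OF _ carr(1)])
      (auto simp: L_def jacobi_op_power_nth prod_list_diag_prod lessThan_atLeast0)
  also have "det U = (\<Prod>i<n. 2 ^ i * fact i)"
    by (subst det_upper_triangular[OF _ carr(2)])
      (auto simp: U_def fps_mult_power_nth jacobi_t_nth jacobi_g_nth_0 prod_list_diag_prod
        lessThan_atLeast0 upper_triangular_def mult.commute simp del: One_nat_def)
  \<comment> \<open>The powers of 2 from \<open>t = 2 x + \<dots>\<close> turn the denominator 4
    into 2.\<close>
  also have "(\<Prod>i<n. ((1 - m) / 4) ^ i * fact (2 * i)) * (\<Prod>i<n. 2 ^ i * fact i) =
      (\<Prod>i<n. ((1 - m) / 2) ^ i * (fact i * fact (2 * i)))"
    unfolding prod.distrib[symmetric]
    by (intro prod.cong refl) (simp add: power_divide field_simps flip: power_mult_distrib)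
  also have "\<dots> = (\<Prod>i<n. ((1 - m) / 2) ^ i) * (\<Prod>i<n. fact i * fact (2 * i))"
    by (rule prod.distrib)
  also have "(\<Prod>i<n. ((1 - m) / 2) ^ i) = ((1 - m) / 2) ^ (n choose 2)"
    by (simp add: power_sum[symmetric] lessThan_atLeast0 Sum_Ico_nat choose_two)
  \<comment> \<open>The dropped index 0 has factor 1.\<close>
  also have "(\<Prod>i<n. fact i * fact (2 * i) :: 'a) = (\<Prod>i=1..n-1. fact i * fact (2 * i))"
    by (rule prod.mono_neutral_right) (auto simp: not_le)
  finally show ?thesis .
qed

end
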